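(* For any class $i\in\{0,1\}$ and any $\epsilon>0$, $$\mathrm{ET}_{i,\epsilon}=\frac12+\frac12\left(\mathrm{P}_{\mathrm{MT},i}-\mathrm{P}_{\mathrm{NT},i}\right),$$ where, for ${\bf X},{\bf Y}$ i.i.d. random samples following the distribution $P_i$ of class $i$, $$\mathrm{P}_{\mathrm{MT},i}=\mathrm{P}\big({\bf Y}\in\mathcal{T}_\epsilon({\bf X}),\ {\bf X}\in\mathcal{T}_\epsilon({\bf Y})\big),\qquad \mathrm{P}_{\mathrm{NT},i}=\mathrm{P}\big({\bf Y}\notin\mathcal{T}_\epsilon({\bf X}),\ {\bf X}\notin\mathcal{T}_\epsilon({\bf Y})\big).$$
   Context: Setting: $\mathcal{X}=\mathbb{R}^n$ is the sample space, $\mathcal{C}=\{0,1\}$ the label space, $f:\mathcal{X}\to\mathcal{C}$ a classifier, and for each class $i\in\mathcal{C}$, $P_i$ is a continuous probability distribution on $\mathcal{X}$ (the sample distribution of class $i$). All events whose probabilities appear are assumed measurable. For ${\bf x}\in\mathcal{X}$, ${\bf v}^*({\bf x})$ denotes an optimal solution of: minimize $\|{\bf v}\|_2$ over ${\bf v}\in\mathcal{X}$ subject to $f({\bf x}+{\bf v})\neq f({\bf x})$ (such a solution is assumed to exist for $P_i$-almost every ${\bf x}$). $\epsilon$-solution set: for $\epsilon>0$, $$\mathcal{V}_\epsilon({\bf x})=\{{\bf v}\in\mathcal{X} : \|{\bf v}\|_2-\|{\bf v}^*({\bf x})\|_2\le\epsilon,\ f({\bf x}+{\bf v})\neq f({\bf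 x})\}.$$ Transferable set: $$\mathcal{T}_\epsilon({\bf x})=\{{\bf y}\in\mathcal{X} : f({\bf y})=f({\bf x}),\ \exists\,{\bf v}\in\mathcal{V}_\epsilon({\bf x})\text{ such that } f({\bf y}+{\bf v})\neq f({\bf y})\}.$$ ET (expected transferability) statistic: for ${\bf X},{\bf Y}$ i.i.d. with distribution $P_i$, $\mathrm{ET}_{i,\epsilon}=\mathbb{E}\big[\mathrm{P}({\bf Y}\in\mathcal{T}_\epsilon({\bf X})\mid{\bf X})\big]$. *)

theory Defs
  imports "HOL-Probability.Probability"
begin

definition continuous_distribution :: "'a::euclidean_space measure \<Rightarrow> bool" where
  "continuous_distribution D \<longleftrightarrow>
     prob_space D \<and> (\<exists>g \<in> borel_measurable lborel. D = density lborel g)"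

definition optimal_perturbation ::
  "('a::real_normed_vector \<Rightarrow> 'c) \<Rightarrow> 'a \<Rightarrow> 'a \<Rightarrow> bool" where
  "optimal_perturbation f x v \<longleftrightarrow> is_arg_min norm (\<lambda>w. f (x + w) \<noteq> f x) v"

text \<open>Optimal solutions need not be unique, so a choice \<open>vs\<close> of an optimal solution for
  each point is a parameter here. At points without an optimal solution its value is arbitrary.\<close>

definition solution_set ::
  "('a::real_normed_vector \<Rightarrow> 'c) \<Rightarrow> ('a \<Rightarrow> 'a) \<Rightarrow> real \<Rightarrow> 'a \<Rightarrow> 'a set" where
  "solution_set f vs \<epsilon> x = {v. norm v - norm (vs x) \<le> \<epsilon> \<and> f (x + v) \<noteq> f x}"

definition transferable_set ::
  "('a::real_normed_vector \<Rightarrow> 'c) \<Rightarrow> ('a \<Rightarrow> 'a) \<Rightarrow> real \<Rightarrow> 'a \<Rightarrow> 'a set" where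
  "transferable_set f vs \<epsilon> x =
     {y. f y = f x \<and> (\<exists>v \<in> solution_set f vs \<epsilon> x. f (y + v) \<noteq> f y)}"

definition iid_pair ::
  "'w measure \<Rightarrow> 'a::topological_space measure \<Rightarrow> ('w \<Rightarrow> 'a) \<Rightarrow> ('w \<Rightarrow> 'a) \<Rightarrow> bool" where
  "iid_pair M D X Y \<longleftrightarrow>
     prob_space.indep_var M borel X borel Y \<and> distr M borel X = D \<and> distr M borel Y = D"

text \<open>The conditional probability of an event given a random variable is the conditional
  expectation of its indicator with respect to the sigma-algebra generated by that variable.\<close>

definition cond_probability ::
  "'w measure \<Rightarrow> ('w \<Rightarrow> 'a::topological_space) \<Rightarrow> 'w set \<Rightarrow> 'w \<Rightarrow> real" where
  "cond_probability M X A =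
     real_cond_exp M (vimage_algebra (space M) X borel) (indicator A)"

definition expected_transferability ::
  "'w measure \<Rightarrow> ('w \<Rightarrow> 'a) \<Rightarrow> ('w \<Rightarrow> 'a) \<Rightarrow>
   ('a::real_normed_vector \<Rightarrow> 'c) \<Rightarrow> ('a \<Rightarrow> 'a) \<Rightarrow> real \<Rightarrow> real" where
  "expected_transferability M X Y f vs \<epsilon> =
     (\<integral>\<omega>. cond_probability M X {\<omega>' \<in> space M. Y \<omega>' \<in> transferable_set f vs \<epsilon> (X \<omega>')} \<omega> \<partial>M)"

definition prob_MT ::
  "'w measure \<Rightarrow> ('w \<Rightarrow> 'a) \<Rightarrow> ('w \<Rightarrow> 'a) \<Rightarrow>
   ('a::real_normed_vector \<Rightarrow> 'c) \<Rightarrow> ('a \<Rightarrow> 'a) \<Rightarrow> real \<Rightarrow> real" where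
  "prob_MT M X Y f vs \<epsilon> =
     measure M {\<omega> \<in> space M. Y \<omega> \<in> transferable_set f vs \<epsilon> (X \<omega>) \<and>
                              X \<omega> \<in> transferable_set f vs \<epsilon> (Y \<omega>)}"

definition prob_NT ::
  "'w measure \<Rightarrow> ('w \<Rightarrow> 'a) \<Rightarrow> ('w \<Rightarrow> 'a) \<Rightarrow>
   ('a::real_normed_vector \<Rightarrow> 'c) \<Rightarrow> ('a \<Rightarrow> 'a) \<Rightarrow> real \<Rightarrow> real" where
  "prob_NT M X Y f vs \<epsilon> =
     measure M {\<omega> \<in> space M. Y \<omega> \<notin> transferable_set f vs \<epsilon> (X \<omega>) \<and>
                              X \<omega> \<notin> transferable_set f vs \<epsilon> (Y \<omega>)}"

text \<open>Measurability of the events \<open>Y \<in> T(X)\<close>, \<open>X \<in> T(Y)\<close> and their Boolean combinations is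
  expressed on the sample space of the pair \<open>(X, Y)\<close>. Measurability of the preimages in the
  underlying probability space alone would not do: on an enlarged sigma-algebra the
  probabilities of such events need not be determined by the joint law of \<open>(X, Y)\<close>.\<close>

definition transfer_event_measurable ::
  "'a::real_normed_vector measure \<Rightarrow> ('a \<Rightarrow> 'c) \<Rightarrow> ('a \<Rightarrow> 'a) \<Rightarrow> real \<Rightarrow> bool" where
  "transfer_event_measurable D f vs \<epsilon> \<longleftrightarrow>
     {(x, y). y \<in> transferable_set f vs \<epsilon> x} \<in> sets (D \<Otimes>\<^sub>M D)"

end

theory Submission
  imports Defs
begin

text \<open>The joint law of an i.i.d. pair is invariant under swapping the two coordinates, so
  \<open>A = {Y \<in> T(X)}\<close> and \<open>B = {X \<in> T(Y)}\<close> have the same probability, and this probability is the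
  expected transferability by the tower property. Inclusion-exclusion gives
  \<open>P(A \<inter> B) - (1 - P(A \<union> B)) = P(A) + P(B) - 1 = 2 P(A) - 1\<close>.\<close>

lemma (in prob_space) expectation_cond_probability:
  assumes "X \<in> borel_measurable M" and "A \<in> events"
  shows "expectation (cond_probability M X A) = prob A"
proof -
  \<comment> \<open>Measurability of \<open>X\<close> enters here: outside the subalgebra case the
    conditional expectation defaults to zero and the tower property would fail.\<close>
  have "subalgebra M (vimage_algebra (space M) X borel)"
    unfolding subalgebra_def sets_vimage_algebra space_vimage_algebra
    using measurable_sets[OF assms(1)] by (intro conjI refl sets.sigma_sets_subset) auto
  then interpret finite_measure_subalgebra M "vimage_algebra (space M) X borel"
    by unfold_locales
  show ?thesis
    unfolding cond_probability_def
    using assms(2) by (subst real_cond_exp_int(2)) (auto simp: emeasure_eq_measure)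
qed

lemma (in prob_space) prob_Int_minus_prob_compl_Un:
  assumes "A \<in> events" and "B \<in> events"
  shows "prob (A \<inter> B) - prob (space M - (A \<union> B)) = prob A + prob B - 1"
  \<comment> \<open>The union is split into \<open>A\<close> and the disjoint remainder
    \<open>B - A\<close>.\<close>
  using assms finite_measure_Union'[OF assms] finite_measure_Diff'[OF assms(2,1)]
  by (simp add: prob_compl Int_commute)

text \<open>Independence amounts to the joint law being the product of the two marginals, and here
  both marginals are \<open>D\<close>.\<close>

lemma (in prob_space) iid_pair_joint_law:
  assumes "iid_pair M D X Y"
  shows "(\<lambda>\<omega>. (X \<omega>, Y \<omega>)) \<in> M \<rightarrow>\<^sub>M borel \<Otimes>\<^sub>M borel"
    and "distr M (borel \<Otimes>\<^sub>M borel) (\<lambda>\<omega>. (X \<omega>, Y \<omega>)) = D \<Otimes>\<^sub>M D"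
  using assms unfolding iid_pair_def indep_var_distribution_eq
  by (auto intro!: measurable_Pair)

lemma iid_pair_swap:
  assumes "prob_space M" and "iid_pair M D X Y"
  shows "iid_pair M D Y X"
proof -
  interpret prob_space M by fact
  have [measurable]: "X \<in> borel_measurable M" "Y \<in> borel_measurable M"
    and D: "distr M borel X = D" "distr M borel Y = D"
    and J: "distr M (borel \<Otimes>\<^sub>M borel) (\<lambda>\<omega>. (X \<omega>, Y \<omega>)) = D \<Otimes>\<^sub>M D"
    using assms(2) unfolding iid_pair_def indep_var_distribution_eq by auto
  interpret D: prob_space D
    unfolding D(1)[symmetric] by (rule prob_space_distr) simp
  interpret DD: pair_sigma_finite D D ..
  have [simp, measurable_cong]: "sets D = sets borel"
    unfolding D(1)[symmetric] by simp
  \<comment> \<open>Read from right to left, the chain computes the law of \<open>(Y, X)\<close>: it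
    is the image of the law of \<open>(X, Y)\<close> under the swap, which fixes the square of a
    sigma-finite measure.\<close>
  have "D \<Otimes>\<^sub>M D = distr (D \<Otimes>\<^sub>M D) (D \<Otimes>\<^sub>M D) (\<lambda>(x, y). (y, x))"
    by (rule DD.distr_pair_swap)
  also have "\<dots> = distr (distr M (borel \<Otimes>\<^sub>M borel) (\<lambda>\<omega>. (X \<omega>, Y \<omega>)))
      (borel \<Otimes>\<^sub>M borel) (\<lambda>(x, y). (y, x))"
    unfolding J by (rule distr_cong) (auto intro!: sets_pair_measure_cong)
  also have "\<dots> = distr M (borel \<Otimes>\<^sub>M borel) (\<lambda>\<omega>. (Y \<omega>, X \<omega>))"
    by (subst distr_distr) (auto simp: comp_def)
  finally show ?thesis
    unfolding iid_pair_def indep_var_distribution_eq by (simp add: D)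
qed

text \<open>The value in the second claim depends on \<open>D\<close> and \<open>R\<close> only, so
  all i.i.d. pairs with law \<open>D\<close> hit \<open>R\<close> with the same probability.\<close>

lemma (in prob_space) iid_pair_event:
  assumes "iid_pair M D X Y" and "R \<in> sets (D \<Otimes>\<^sub>M D)"
  shows "{\<omega> \<in> space M. (X \<omega>, Y \<omega>) \<in> R} \<in> events"
    and "prob {\<omega> \<in> space M. (X \<omega>, Y \<omega>) \<in> R} = measure (D \<Otimes>\<^sub>M D) R"
proof -
  note J = iid_pair_joint_law[OF assms(1)]
  \<comment> \<open>As an image measure, \<open>D \<Otimes>\<^sub>M D\<close> has the sigma-algebra
    of its target.\<close>
  have R: "R \<in> sets (borel \<Otimes>\<^sub>M borel)"
    using assms(2) arg_cong[OF J(2), of sets] by simp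
  have E: "{\<omega> \<in> space M. (X \<omega>, Y \<omega>) \<in> R} = (\<lambda>\<omega>. (X \<omega>, Y \<omega>)) -` R \<inter> space M"
    by auto
  show "{\<omega> \<in> space M. (X \<omega>, Y \<omega>) \<in> R} \<in> events"
    unfolding E using J(1) R by (rule measurable_sets)
  show "prob {\<omega> \<in> space M. (X \<omega>, Y \<omega>) \<in> R} = measure (D \<Otimes>\<^sub>M D) R"
    unfolding E J(2)[symmetric] using J(1) R by (simp add: measure_distr)
qed

theorem theorem3p1:
  fixes f :: "real ^ 'n \<Rightarrow> nat"
    and P :: "nat \<Rightarrow> (real ^ 'n) measure"
    and vs :: "real ^ 'n \<Rightarrow> real ^ 'n"
    and M :: "'w measure"
    and X Y :: "'w \<Rightarrow> real ^ 'n"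
    and i :: nat and \<epsilon> :: real
  assumes "\<And>x. f x \<in> {0, 1}"
    and "\<And>j. j \<in> {0, 1} \<Longrightarrow> continuous_distribution (P j)"
    and "\<And>j. j \<in> {0, 1} \<Longrightarrow> (AE x in P j. optimal_perturbation f x (vs x))"
    and "i \<in> {0, 1}"
    and "\<epsilon> > 0"
    and "prob_space M"
    and "iid_pair M (P i) X Y"
    and "transfer_event_measurable (P i) f vs \<epsilon>"
  shows "expected_transferability M X Y f vs \<epsilon> =
           1 / 2 + 1 / 2 * (prob_MT M X Y f vs \<epsilon> - prob_NT M X Y f vs \<epsilon>)"
proof -
  interpret prob_space M by fact
  let ?T = "transferable_set f vs \<epsilon>"
  define A where "A = {\<omega> \<in> space M. Y \<omega> \<in> ?T (X \<omega>)}"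
  define B where "B = {\<omega> \<in> space M. X \<omega> \<in> ?T (Y \<omega>)}"
  have R: "{(x, y). y \<in> ?T x} \<in> sets (P i \<Otimes>\<^sub>M P i)"
    using assms(8) by (simp add: transfer_event_measurable_def)
  note A = iid_pair_event[OF assms(7) R, simplified, folded A_def]
  \<comment> \<open>The same relation is used for the swapped pair: \<open>(Y, X)\<close> lies in it
    exactly when \<open>X\<close> is in the transferable set of \<open>Y\<close>. Hence
    \<open>A\<close> and \<open>B\<close> receive one common value, the product measure of the
    relation.\<close>
  note B = iid_pair_event[OF iid_pair_swap[OF assms(6,7)] R, simplified, folded B_def]
  have X: "X \<in> borel_measurable M"
    using assms(7) by (auto simp: iid_pair_def indep_var_distribution_eq)
  have "expected_transferability M X Y f vs \<epsilon> = prob A"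
    unfolding expected_transferability_def A_def[symmetric]
    by (rule expectation_cond_probability[OF X A(1)])
  moreover have "prob_MT M X Y f vs \<epsilon> = prob (A \<inter> B)"
    unfolding prob_MT_def by (rule arg_cong[where f = prob]) (auto simp: A_def B_def)
  moreover have "prob_NT M X Y f vs \<epsilon> = prob (space M - (A \<union> B))"
    unfolding prob_NT_def by (rule arg_cong[where f = prob]) (auto simp: A_def B_def)
  moreover have "prob B = prob A"
    using A(2) B(2) by simp
  ultimately show ?thesis
    using prob_Int_minus_prob_compl_Un[OF A(1) B(1)] by (simp add: field_simps)
qed

end
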